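(* Let $\mathsf{A}\subset M_d(\mathbb{R})$ be compact and nonempty with $\varrho(\mathsf{A})=1$ and let $(a_n)$ be its marginal instability rate sequence (with respect to any norm on $M_d(\mathbb{R})$). Then there exists $\kappa>0$ such that $a_{n+1}\geq\kappa a_n$ for every $n\geq 1$.
   Context: $M_d(\mathbb{R})$ is the set of $d\times d$ real matrices and $\|\cdot\|$ is the Euclidean operator norm. For $\mathsf{A}\subset M_d(\mathbb{R})$ and $n\geq 1$, $\mathsf{A}_n:=\{A_1\cdots A_n\colon A_i\in\mathsf{A}\}$ (products of $n$ elements of $\mathsf{A}$). The joint spectral radius of a bounded nonempty set $\mathsf{A}$ is $\varrho(\mathsf{A})=\lim_{n\to\infty}\sup_{A\in\mathsf{A}_n}\|A\|^{1/n}$. If $\varrho(\mathsf{A})=1$, the marginal instability rate sequence of $\mathsf{A}$ with respect to a norm $|||\cdot|||$ on $M_d(\mathbb{R})$ is $(a_n)_{n=1}^\infty$ with $a_n=\max_{A\in\mathsf{A}_n}|||A|||$. *)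

theory Defs
  imports "HOL-Analysis.Analysis"
begin

(* Lists rather than an iterated product operator: the multiplication "*" on
   real^'d^'d is componentwise, so the matrix product is "**". *)
definition matrix_products :: "(real^'d^'d) set \<Rightarrow> nat \<Rightarrow> (real^'d^'d) set"
  where "matrix_products A n =
    {foldr (**) Bs (mat 1) |Bs. length Bs = n \<and> set Bs \<subseteq> A}"

(* The value of the sequence at n = 0 is immaterial for the limit. The limit exists
   whenever A is bounded and nonempty, so "lim" is then the actual limit. *)
definition joint_spectral_radius :: "(real^'d^'d) set \<Rightarrow> real"
  where "joint_spectral_radius A =
    lim (\<lambda>n. SUP B\<in>matrix_products A n. root n (onorm ((*v) B)))"

definition is_norm :: "('a::real_vector \<Rightarrow> real) \<Rightarrow> bool"
  where "is_norm N \<longleftrightarrow>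
    (\<forall>x. 0 \<le> N x) \<and>
    (\<forall>x. N x = 0 \<longleftrightarrow> x = 0) \<and>
    (\<forall>c x. N (c *\<^sub>R x) = \<bar>c\<bar> * N x) \<and>
    (\<forall>x y. N (x + y) \<le> N x + N y)"

(* GREATEST is the maximum itself; "Max" is only meaningful for finite sets. The
   maximum is attained for compact nonempty A, since matrix_products A n is then
   compact and nonempty and every norm N is continuous. *)
definition marginal_instability_rate ::
    "((real^'d^'d) \<Rightarrow> real) \<Rightarrow> (real^'d^'d) set \<Rightarrow> nat \<Rightarrow> real"
  where "marginal_instability_rate N A n =
    (GREATEST r. r \<in> N ` matrix_products A n)"

end

theory Submission
  imports Defs
begin

text \<open>
  Let \<open>L\<^sub>n\<close> be the left ideal of matrices generated by the products of length \<open>n\<close>. Splitting off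
  the first factor of a product gives \<open>L\<^sub>n\<^sub>+\<^sub>1 \<subseteq> L\<^sub>n\<close>, so by finite dimensionality
  \<open>L\<^sub>m\<^sub>+\<^sub>1 = L\<^sub>m\<close> for some \<open>m\<close>. Hence every product \<open>B\<close> of length \<open>m\<close> is a linear combination,
  with uniformly bounded coefficients, of finitely many matrices \<open>X D\<close> with \<open>D\<close> a product of length
  \<open>m + 1\<close>. Multiplying on the right by products of length \<open>n - m\<close> bounds \<open>a\<^sub>n\<close> by a constant multiple
  of \<open>a\<^sub>n\<^sub>+\<^sub>1\<close> for all \<open>n \<ge> m\<close>. The joint spectral radius only enters for the finitely many
  \<open>n < m\<close>: since it is nonzero, no \<open>a\<^sub>n\<close> vanishes.
\<close>

section \<open>Bilinearity of the matrix product\<close>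

lemma matrix_add_rdistrib:
  fixes A B :: "'a::semiring_1^'n^'m"
  shows "(A + B) ** C = A ** C + B ** C"
  by (simp add: matrix_matrix_mult_def vec_eq_iff distrib_right sum.distrib)

lemma bounded_bilinear_matrix_matrix_mult:
  "bounded_bilinear ((**) :: real^'n^'m \<Rightarrow> real^'p^'n \<Rightarrow> real^'p^'m)"
proof -
  have "bilinear ((**) :: real^'n^'m \<Rightarrow> real^'p^'n \<Rightarrow> real^'p^'m)"
    unfolding bilinear_def
    by (auto intro!: linearI
        simp: matrix_add_ldistrib matrix_add_rdistrib matrix_scalar_ac scalar_matrix_assoc)
  then show ?thesis
    by (simp add: bilinear_conv_bounded_bilinear)
qed

section \<open>Equivalence of an arbitrary norm with the Euclidean one\<close>

lemma is_norm_zero: "is_norm N \<Longrightarrow> N 0 = 0"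
  by (simp add: is_norm_def)

lemma is_norm_sum_le:
  assumes "is_norm N"
  shows "N (\<Sum>i\<in>I. f i) \<le> (\<Sum>i\<in>I. N (f i))"
proof (induction I rule: infinite_finite_induct)
  case (insert i I)
  have "N (f i + sum f I) \<le> N (f i) + N (sum f I)"
    using assms by (simp add: is_norm_def)
  with insert show ?case by simp
qed (use assms in \<open>simp_all add: is_norm_zero\<close>)

lemma is_norm_le_norm:
  fixes N :: "'a::euclidean_space \<Rightarrow> real"
  assumes "is_norm N"
  obtains c where "c > 0" "\<And>x. N x \<le> c * norm x"
proof
  \<comment> \<open>The summand \<open>1\<close> yields \<open>c > 0\<close> from nonnegativity of
    \<open>N\<close> alone.\<close>
  define c where "c = (\<Sum>b\<in>Basis. N b) + 1"
  have pos: "0 \<le> N x" for x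
    using assms by (simp add: is_norm_def)
  show "c > 0"
    unfolding c_def using sum_nonneg[of Basis N] pos by (simp add: add_nonneg_pos)
  show "N x \<le> c * norm x" for x
  proof -
    have "N x = N (\<Sum>b\<in>Basis. (x \<bullet> b) *\<^sub>R b)"
      by (simp add: euclidean_representation)
    also have "\<dots> \<le> (\<Sum>b\<in>Basis. \<bar>x \<bullet> b\<bar> * N b)"
      using is_norm_sum_le[OF assms, of "\<lambda>b. (x \<bullet> b) *\<^sub>R b" Basis] assms
      by (simp add: is_norm_def)
    also have "\<dots> \<le> (\<Sum>b\<in>Basis. norm x * N b)"
      by (intro sum_mono mult_right_mono pos) (simp add: Basis_le_norm)
    also have "\<dots> \<le> c * norm x"
      by (simp add: c_def flip: sum_distrib_left) (simp add: algebra_simps)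
    finally show ?thesis .
  qed
qed

text \<open>The reverse triangle inequality, combined with the bound by the Euclidean norm, makes
  \<open>N\<close> Lipschitz.\<close>

lemma is_norm_continuous_on:
  fixes N :: "'a::euclidean_space \<Rightarrow> real"
  assumes "is_norm N"
  shows "continuous_on S N"
proof -
  obtain c where c: "c > 0" "\<And>x. N x \<le> c * norm x"
    using is_norm_le_norm[OF assms] by blast
  have "\<bar>N x - N y\<bar> \<le> c * dist x y" for x y
  proof -
    have tri: "N u \<le> N v + N (u - v)" for u v
      using assms unfolding is_norm_def by (metis add.commute diff_add_cancel)
    have "N (y - x) = N (x - y)"
      using assms unfolding is_norm_def
      by (metis abs_minus_cancel abs_one minus_diff_eq mult_1 scaleR_minus1_left)
    with tri[of x y] tri[of y x] c(2)[of "x - y"] show ?thesis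
      by (simp add: dist_norm)
  qed
  then have "c-lipschitz_on S N"
    using c(1) by (intro lipschitz_onI) (auto simp: dist_real_def)
  then show ?thesis
    by (rule lipschitz_on_continuous_on)
qed

text \<open>By continuity \<open>N\<close> attains a minimum on the compact unit sphere; it is
  positive by definiteness, and homogeneity carries the estimate to all vectors.\<close>

lemma norm_le_is_norm:
  fixes N :: "'a::euclidean_space \<Rightarrow> real"
  assumes "is_norm N"
  obtains c where "c > 0" "\<And>x. norm x \<le> c * N x"
proof -
  obtain b :: 'a where "b \<in> Basis"
    using nonempty_Basis by blast
  then have "sphere (0::'a) 1 \<noteq> {}"
    by (auto intro!: exI[of _ b])
  then obtain u :: 'a where u: "norm u = 1" "\<And>y. norm y = 1 \<Longrightarrow> N u \<le> N y"
    using continuous_attains_inf[OF compact_sphere _ is_norm_continuous_on[OF assms], of 0 1]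
    by auto
  have "u \<noteq> 0"
    using u(1) by auto
  then have Nu: "N u > 0"
    using assms unfolding is_norm_def by (metis less_eq_real_def)
  have "norm x \<le> (1 / N u) * N x" for x
  proof (cases "x = 0")
    case False
    have "N u \<le> N ((1 / norm x) *\<^sub>R x)"
      by (rule u(2)) (use False in simp)
    also have "\<dots> = N x / norm x"
      using assms by (simp add: is_norm_def)
    finally show ?thesis
      using False Nu by (simp add: field_simps)
  qed (use assms in \<open>simp add: is_norm_def\<close>)
  with Nu that show ?thesis
    by (metis divide_pos_pos zero_less_one)
qed

text \<open>Stands in for submultiplicativity, which an arbitrary norm may lack: \<open>k\<close>
  depends on \<open>X\<close> and comes from passing to the Euclidean norm and back.\<close>

lemma is_norm_matrix_mult_le:
  fixes N :: "real^'d^'d \<Rightarrow> real" and X :: "real^'d^'d"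
  assumes "is_norm N"
  obtains k where "k \<ge> 0" "\<And>Z. N (X ** Z) \<le> k * N Z"
proof -
  obtain c where c: "c > 0" "\<And>x. N x \<le> c * norm x"
    using is_norm_le_norm[OF assms] by blast
  obtain c' where c': "c' > 0" "\<And>x. norm x \<le> c' * N x"
    using norm_le_is_norm[OF assms] by blast
  obtain K where K: "K \<ge> 0" "\<And>Z :: real^'d^'d. norm (X ** Z) \<le> norm Z * K"
    using bounded_linear.nonneg_bounded[OF
        bounded_bilinear.bounded_linear_right[OF bounded_bilinear_matrix_matrix_mult]]
    by metis
  show ?thesis
  proof
    show "c * (c' * K) \<ge> 0"
      using c(1) c'(1) K(1) by simp
    show "N (X ** Z) \<le> c * (c' * K) * N Z" for Z
    proof -
      have "norm (X ** Z) \<le> (c' * N Z) * K"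
        using K(2)[of Z] mult_right_mono[OF c'(2)[of Z] K(1)] by simp
      then have "c * norm (X ** Z) \<le> c * ((c' * N Z) * K)"
        using c(1) by simp
      with c(2)[of "X ** Z"] show ?thesis
        by (simp add: mult_ac)
    qed
  qed
qed

section \<open>Algebra and compactness of the product sets\<close>

lemma matrix_products_0: "matrix_products A 0 = {mat 1}"
  by (auto simp: matrix_products_def)

lemma matrix_products_Suc:
  "matrix_products A (Suc n) = (\<lambda>(X, Y). X ** Y) ` (A \<times> matrix_products A n)"
proof (intro equalityI subsetI)
  fix Z assume "Z \<in> matrix_products A (Suc n)"
  then obtain Bs where "Z = foldr (**) Bs (mat 1)" "length Bs = Suc n" "set Bs \<subseteq> A"
    by (auto simp: matrix_products_def)
  then show "Z \<in> (\<lambda>(X, Y). X ** Y) ` (A \<times> matrix_products A n)"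
    by (cases Bs) (auto simp: matrix_products_def)
next
  fix Z assume "Z \<in> (\<lambda>(X, Y). X ** Y) ` (A \<times> matrix_products A n)"
  then obtain X Bs where "Z = X ** foldr (**) Bs (mat 1)" "X \<in> A" "length Bs = n" "set Bs \<subseteq> A"
    by (auto simp: matrix_products_def)
  then show "Z \<in> matrix_products A (Suc n)"
    unfolding matrix_products_def by (auto intro!: exI[of _ "X # Bs"])
qed

lemma matrix_products_add:
  fixes A :: "(real^'d^'d) set"
  shows "matrix_products A (m + n) =
    (\<lambda>(X, Y). X ** Y) ` (matrix_products A m \<times> matrix_products A n)"
proof (induction m)
  case 0
  then show ?case by (force simp: matrix_products_0)
next
  case (Suc m)
  let ?mult = "\<lambda>(X, Y). X ** Y :: real^'d^'d"
  have "?mult ` (A \<times> ?mult ` (P \<times> Q)) = ?mult ` (?mult ` (A \<times> P) \<times> Q)"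
    for P Q :: "(real^'d^'d) set"
  proof -
    have "?mult ` (A \<times> ?mult ` (P \<times> Q)) = (\<Union>X\<in>A. \<Union>Y\<in>P. \<Union>Z\<in>Q. {X ** (Y ** Z)})"
      by auto
    also have "\<dots> = (\<Union>X\<in>A. \<Union>Y\<in>P. \<Union>Z\<in>Q. {(X ** Y) ** Z})"
      by (simp add: matrix_mul_assoc)
    also have "\<dots> = ?mult ` (?mult ` (A \<times> P) \<times> Q)"
      by auto
    finally show ?thesis .
  qed
  with Suc show ?case
    by (simp add: matrix_products_Suc)
qed

lemma compact_matrix_products:
  fixes A :: "(real^'d^'d) set"
  assumes "compact A"
  shows "compact (matrix_products A n)"
proof (induction n)
  case (Suc n)
  have "continuous_on S (\<lambda>(X, Y). X ** Y)" for S :: "((real^'d^'d) \<times> (real^'d^'d)) set"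
    unfolding case_prod_unfold
    by (intro bounded_bilinear.continuous_on[OF bounded_bilinear_matrix_matrix_mult]
        continuous_on_fst continuous_on_snd continuous_on_id)
  with Suc assms show ?case
    unfolding matrix_products_Suc by (intro compact_continuous_image compact_Times)
qed (simp add: matrix_products_0)

lemma matrix_products_nonempty: "A \<noteq> {} \<Longrightarrow> matrix_products A n \<noteq> {}"
  by (induction n) (auto simp: matrix_products_0 matrix_products_Suc)

section \<open>Attained maxima and their positivity\<close>

lemma marginal_instability_rate_max:
  fixes A :: "(real^'d^'d) set"
  assumes "compact A" "A \<noteq> {}" "is_norm N"
  shows "\<exists>X\<in>matrix_products A n. marginal_instability_rate N A n = N X"
    and "\<And>Y. Y \<in> matrix_products A n \<Longrightarrow> N Y \<le> marginal_instability_rate N A n"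
proof -
  obtain X where X: "X \<in> matrix_products A n" "\<And>Y. Y \<in> matrix_products A n \<Longrightarrow> N Y \<le> N X"
    using continuous_attains_sup[OF compact_matrix_products[OF assms(1)]
        matrix_products_nonempty[OF assms(2)] is_norm_continuous_on[OF assms(3)]] by metis
  then have "marginal_instability_rate N A n = N X"
    unfolding marginal_instability_rate_def by (intro Greatest_equality) auto
  with X show "\<exists>X\<in>matrix_products A n. marginal_instability_rate N A n = N X"
    and "\<And>Y. Y \<in> matrix_products A n \<Longrightarrow> N Y \<le> marginal_instability_rate N A n"
    by auto
qed

lemma joint_spectral_radius_nilpotent:
  fixes A :: "(real^'d^'d) set"
  assumes "A \<noteq> {}" "matrix_products A n \<subseteq> {0}"
  shows "joint_spectral_radius A = 0"
proof -
  have "(SUP B\<in>matrix_products A k. root k (onorm ((*v) B))) = 0" if "k \<ge> n" for k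
  proof -
    \<comment> \<open>The first \<open>n\<close> factors of a longer product already multiply to
      zero, so the sequence defining the limit is eventually zero.\<close>
    have "matrix_products A (n + (k - n)) \<subseteq> {0}"
      using assms(2) by (auto simp: matrix_products_add)
    then have "matrix_products A k = {0}"
      using that matrix_products_nonempty[OF assms(1), of k] by auto
    moreover have "((*v) (0::real^'d^'d)) = (\<lambda>x. 0)"
      by (rule ext) simp
    ultimately show ?thesis
      by (simp add: onorm_zero)
  qed
  then have "(\<lambda>k. SUP B\<in>matrix_products A k. root k (onorm ((*v) B))) \<longlonglongrightarrow> 0"
    by (intro tendsto_eventually eventually_sequentiallyI)
  then show ?thesis
    unfolding joint_spectral_radius_def by (rule limI)
qed

lemma marginal_instability_rate_pos:
  fixes A :: "(real^'d^'d) set"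
  assumes "compact A" "A \<noteq> {}" "is_norm N" "joint_spectral_radius A \<noteq> 0"
  shows "marginal_instability_rate N A n > 0"
proof (rule ccontr)
  assume neg: "\<not> ?thesis"
  have "matrix_products A n \<subseteq> {0}"
  proof
    fix Y assume "Y \<in> matrix_products A n"
    then have "N Y \<le> 0"
      using marginal_instability_rate_max(2)[OF assms(1-3), of Y n] neg by linarith
    moreover have "0 \<le> N Y"
      using assms(3) by (simp add: is_norm_def)
    ultimately have "N Y = 0"
      by linarith
    then show "Y \<in> {0}"
      using assms(3) by (simp add: is_norm_def)
  qed
  with joint_spectral_radius_nilpotent assms show False
    by blast
qed

section \<open>The descending chain of left ideals and the resulting bounds\<close>

definition product_left_ideal :: "(real^'d^'d) set \<Rightarrow> nat \<Rightarrow> (real^'d^'d) set" where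
  "product_left_ideal A n = span {X ** C |X C. C \<in> matrix_products A n}"

lemma matrix_products_subset_left_ideal: "matrix_products A n \<subseteq> product_left_ideal A n"
  unfolding product_left_ideal_def
proof
  fix C assume "C \<in> matrix_products A n"
  then have "mat 1 ** C \<in> {X ** C |X C. C \<in> matrix_products A n}"
    by blast
  then show "C \<in> span {X ** C |X C. C \<in> matrix_products A n}"
    by (simp add: span_base)
qed

lemma product_left_ideal_Suc_subset: "product_left_ideal A (Suc n) \<subseteq> product_left_ideal A n"
  unfolding product_left_ideal_def
  by (intro span_mono) (auto simp: matrix_products_Suc matrix_mul_assoc, blast)

text \<open>The ideals are nested subspaces of a finite-dimensional space. At an index of least
  dimension the next ideal has the same dimension, hence equals it.\<close>

lemma product_left_ideal_stabilizes:
  "\<exists>m. product_left_ideal A (Suc m) = product_left_ideal A m"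
proof -
  obtain m where m: "\<And>j. dim (product_left_ideal A m) \<le> dim (product_left_ideal A j)"
    using ex_has_least_nat[of "\<lambda>_. True" 0 "\<lambda>j. dim (product_left_ideal A j)"] by auto
  have "subspace (product_left_ideal A j)" for j
    by (simp add: product_left_ideal_def)
  then have "product_left_ideal A (Suc m) = product_left_ideal A m"
    using subspace_dim_equal product_left_ideal_Suc_subset m by metis
  then show ?thesis ..
qed

text \<open>The point is uniformity: \<open>k\<close> depends on \<open>Y\<close> but neither on
  \<open>C\<close> nor on its length \<open>n\<close>. For a generator \<open>X ** D\<close>, the
  product \<open>D ** C\<close> has length \<open>m + n\<close>, and only left multiplication by
  \<open>X\<close> costs a constant; linear combinations follow by the triangle inequality.\<close>

lemma product_left_ideal_bound:
  fixes A :: "(real^'d^'d) set"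
  assumes "compact A" "A \<noteq> {}" "is_norm N" "Y \<in> product_left_ideal A m"
  obtains k where "k \<ge> 0" "\<And>n C. C \<in> matrix_products A n \<Longrightarrow>
    N (Y ** C) \<le> k * marginal_instability_rate N A (m + n)"
proof -
  let ?a = "marginal_instability_rate N A"
  have "\<exists>k\<ge>0. \<forall>n. \<forall>C\<in>matrix_products A n. N (Y ** C) \<le> k * ?a (m + n)"
    using assms(4) unfolding product_left_ideal_def
  proof (induction rule: span_induct_alt)
    case base
    then show ?case
      using assms(3) by (intro exI[of _ 0]) (simp add: is_norm_zero)
  next
    \<comment> \<open>\<open>Y\<close> is now a generator \<open>X ** D\<close>, and
      \<open>Z\<close> is the combination built so far.\<close>
    case (step c Y Z)
    then obtain k X D where k: "k \<ge> 0" "\<And>n C. C \<in> matrix_products A n \<Longrightarrow> N (Z ** C) \<le> k * ?a (m + n)"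
      and D: "Y = X ** D" "D \<in> matrix_products A m"
      by blast
    obtain l where l: "l \<ge> 0" "\<And>Z. N (X ** Z) \<le> l * N Z"
      using is_norm_matrix_mult_le[OF assms(3)] by blast
    have "N ((c *\<^sub>R Y + Z) ** C) \<le> (\<bar>c\<bar> * l + k) * ?a (m + n)" if C: "C \<in> matrix_products A n" for n C
    proof -
      have "D ** C \<in> matrix_products A (m + n)"
        using C D(2) by (auto simp: matrix_products_add)
      then have "l * N (D ** C) \<le> l * ?a (m + n)"
        using marginal_instability_rate_max(2)[OF assms(1-3)] l(1) by (simp add: mult_left_mono)
      then have "N (Y ** C) \<le> l * ?a (m + n)"
        using l(2)[of "D ** C"] by (simp add: D(1) matrix_mul_assoc)
      then have "\<bar>c\<bar> * N (Y ** C) \<le> \<bar>c\<bar> * (l * ?a (m + n))"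
        by (simp add: mult_left_mono)
      moreover have "N ((c *\<^sub>R Y + Z) ** C) \<le> \<bar>c\<bar> * N (Y ** C) + N (Z ** C)"
        using assms(3) unfolding is_norm_def matrix_add_rdistrib scalar_matrix_assoc[symmetric]
        by metis
      ultimately show ?thesis
        using k(2)[OF C] by (simp add: algebra_simps)
    qed
    moreover have "\<bar>c\<bar> * l + k \<ge> 0"
      using l(1) k(1) by simp
    ultimately show ?case
      by blast
  qed
  with that show ?thesis
    by blast
qed

lemma marginal_instability_rate_le_Suc_eventually:
  fixes A :: "(real^'d^'d) set"
  assumes "compact A" "A \<noteq> {}" "is_norm N"
  obtains m M where "M \<ge> 0"
    "\<And>n. m \<le> n \<Longrightarrow> marginal_instability_rate N A n \<le> M * marginal_instability_rate N A (Suc n)"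
proof -
  let ?a = "marginal_instability_rate N A"
  obtain m where m: "product_left_ideal A (Suc m) = product_left_ideal A m"
    using product_left_ideal_stabilizes by blast
  \<comment> \<open>Orthonormality makes the coefficients of \<open>B\<close> the inner products
    \<open>B \<bullet> e\<close>, which Cauchy-Schwarz bounds by \<open>norm B\<close>.\<close>
  obtain E where E: "pairwise orthogonal E" "\<And>x. x \<in> E \<Longrightarrow> norm x = 1"
    "independent E" "span E = product_left_ideal A (Suc m)"
    by (rule orthonormal_basis_subspace[of "product_left_ideal A (Suc m)"])
      (auto simp: product_left_ideal_def)
  have "finite E"
    using E(3) by (simp add: independent_imp_finite)
  have "\<exists>k\<ge>0. \<forall>n. \<forall>C\<in>matrix_products A n. N (e ** C) \<le> k * ?a (Suc m + n)" if "e \<in> E" for e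
  proof -
    have "e \<in> product_left_ideal A (Suc m)"
      using that E(4) span_superset by blast
    from product_left_ideal_bound[OF assms this] show ?thesis
      by metis
  qed
  then obtain k where k: "\<And>e. e \<in> E \<Longrightarrow> k e \<ge> 0"
    "\<And>e n C. e \<in> E \<Longrightarrow> C \<in> matrix_products A n \<Longrightarrow> N (e ** C) \<le> k e * ?a (Suc m + n)"
    by metis
  \<comment> \<open>Compactness bounds all these coefficients at once, so the final constant is
    independent of the maximizing product.\<close>
  obtain R where R: "\<And>B. B \<in> matrix_products A m \<Longrightarrow> norm B \<le> R" "R > 0"
    using compact_imp_bounded[OF compact_matrix_products[OF assms(1)], of m] bounded_pos by metis
  show ?thesis
  proof
    show "(\<Sum>e\<in>E. R * k e) \<ge> 0"
      using k(1) R(2) by (intro sum_nonneg) simp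
    fix n assume "m \<le> n"
    then obtain j where n: "n = m + j"
      using le_Suc_ex by blast
    obtain B C where B: "B \<in> matrix_products A m" and C: "C \<in> matrix_products A j"
      and a: "?a n = N (B ** C)"
      using marginal_instability_rate_max(1)[OF assms, of n] by (auto simp: n matrix_products_add)
    \<comment> \<open>Stabilization enters here: \<open>B\<close> has only \<open>m\<close> factors,
      yet it lies in the ideal generated by products of length \<open>Suc m\<close>.\<close>
    have "B \<in> span E"
      using B matrix_products_subset_left_ideal m E(4) by blast
    then have "B = (\<Sum>e\<in>E. (B \<bullet> e) *\<^sub>R e)"
      using orthonormal_basis_expand[OF E(1,2) _ \<open>finite E\<close>] by simp
    then have "B ** C = (\<Sum>e\<in>E. (B \<bullet> e) *\<^sub>R e) ** C"
      by simp
    also have "\<dots> = (\<Sum>e\<in>E. (B \<bullet> e) *\<^sub>R (e ** C))"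
      by (simp add: bounded_bilinear.sum_left[OF bounded_bilinear_matrix_matrix_mult]
          flip: scalar_matrix_assoc)
    finally have "?a n \<le> (\<Sum>e\<in>E. N ((B \<bullet> e) *\<^sub>R (e ** C)))"
      using is_norm_sum_le[OF assms(3)] by (simp add: a)
    also have "\<dots> = (\<Sum>e\<in>E. \<bar>B \<bullet> e\<bar> * N (e ** C))"
      using assms(3) by (simp add: is_norm_def)
    also have "\<dots> \<le> (\<Sum>e\<in>E. R * (k e * ?a (Suc n)))"
    proof (rule sum_mono)
      fix e assume e: "e \<in> E"
      have "\<bar>B \<bullet> e\<bar> \<le> R"
        using Cauchy_Schwarz_ineq2[of B e] E(2)[OF e] R(1)[OF B] by simp
      moreover have "0 \<le> N (e ** C)"
        using assms(3) by (simp add: is_norm_def)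
      \<comment> \<open>The gained factor shows in the index:
        \<open>Suc m + j = Suc n\<close>.\<close>
      ultimately show "\<bar>B \<bullet> e\<bar> * N (e ** C) \<le> R * (k e * ?a (Suc n))"
        using k(2)[OF e C] R(2) by (intro mult_mono) (auto simp: n)
    qed
    also have "\<dots> = (\<Sum>e\<in>E. R * k e) * ?a (Suc n)"
      by (simp add: sum_distrib_right mult.assoc)
    finally show "?a n \<le> (\<Sum>e\<in>E. R * k e) * ?a (Suc n)" .
  qed
qed

theorem theorem4:
  fixes A :: "(real^'d^'d) set" and N :: "real^'d^'d \<Rightarrow> real"
  assumes "compact A"
    and "A \<noteq> {}"
    and "joint_spectral_radius A = 1"
    and "is_norm N"
  shows "\<exists>\<kappa>::real. \<kappa> > 0 \<and>
    (\<forall>n\<ge>1. marginal_instability_rate N A (n + 1) \<ge> \<kappa> * marginal_instability_rate N A n)"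
proof -
  let ?a = "marginal_instability_rate N A"
  obtain m M where M: "M \<ge> 0" "\<And>n. m \<le> n \<Longrightarrow> ?a n \<le> M * ?a (Suc n)"
    using marginal_instability_rate_le_Suc_eventually[OF assms(1,2,4)] by metis
  have pos: "?a n > 0" for n
    using marginal_instability_rate_pos[OF assms(1,2,4)] assms(3) by simp
  \<comment> \<open>A sum of nonnegative ratios dominates each of them, and it also makes sense for
    \<open>m = 0\<close>.\<close>
  define Q where "Q = (\<Sum>n<m. ?a n / ?a (Suc n))"
  have Q: "Q \<ge> 0"
    unfolding Q_def using pos by (intro sum_nonneg) (simp add: less_imp_le)
  \<comment> \<open>\<open>M\<close> serves the indices from \<open>m\<close> on and
    \<open>Q\<close> those below; the \<open>1\<close> makes the constant positive, so that its
    reciprocal can serve as \<kappa>.\<close>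
  have bound: "?a n \<le> (M + Q + 1) * ?a (Suc n)" for n
  proof (cases "m \<le> n")
    case True
    have "M * ?a (Suc n) \<le> (M + Q + 1) * ?a (Suc n)"
      using Q pos[of "Suc n"] by (intro mult_right_mono) auto
    with M(2)[OF True] show ?thesis by linarith
  next
    case False
    then have "?a n / ?a (Suc n) \<le> Q"
      unfolding Q_def using pos
      by (intro member_le_sum) (auto simp: less_imp_le)
    then have "?a n \<le> Q * ?a (Suc n)"
      using pos[of "Suc n"] by (simp add: field_simps)
    also have "\<dots> \<le> (M + Q + 1) * ?a (Suc n)"
      using M(1) pos[of "Suc n"] by (intro mult_right_mono) auto
    finally show ?thesis .
  qed
  have "M + Q + 1 > 0"
    using M(1) Q by linarith
  then have "1 / (M + Q + 1) > 0" "\<forall>n\<ge>1. ?a (n + 1) \<ge> 1 / (M + Q + 1) * ?a n"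
    using bound by (auto simp: field_simps)
  then show ?thesis
    by blast
qed

end
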